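(* Let $m$ be a positive integer, $q=2^m$, and $\gamma\in\mathbb{F}_q$. Then the compositional inverse of the permutation polynomial $f_2(x)=x+\gamma\operatorname{Tr}_{q}^{q^2}(x+x^2+x^3+x^{q+2})$ over $\mathbb{F}_{q^2}$ is $$f_2^{-1}(x)=x+\gamma\operatorname{Tr}_{q}^{q^2}(x)+\gamma(\operatorname{Tr}_{q}^{q^2}(x))^2+\gamma(\operatorname{Tr}_{q}^{q^2}(x))^3.$$
   Context: $\mathbb{F}_{q^2}$ is the finite field with $q^2$ elements and $\mathbb{F}_q$ its subfield with $q$ elements. $\operatorname{Tr}_q^{q^2}(z)=z+z^q$ for $z\in\mathbb{F}_{q^2}$. A polynomial $f\in\mathbb{F}_{q^2}[x]$ is a permutation polynomial over $\mathbb{F}_{q^2}$ if the map $a\mapsto f(a)$ is a bijection of $\mathbb{F}_{q^2}$. Its compositional inverse $f^{-1}$ is the polynomial $g$ (polynomials being identified with the maps $\mathbb{F}_{q^2}\to\mathbb{F}_{q^2}$ they induce) such that $f(g(x))=g(f(x))=x$ for every $x\in\mathbb{F}_{q^2}$. *)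

theory Defs
  imports
    "HOL-Library.Cardinality"
    "HOL-Computational_Algebra.Primes"
    "HOL-Computational_Algebra.Polynomial"
    "HOL-Algebra.Subrings"
    "HOL-Algebra.Algebraic_Closure_Type"
begin

(* Used both on elements of the field with q^2 elements and, with the same formula, on
   polynomials over it; trace_poly relates the two. *)
definition trace :: "nat \<Rightarrow> 'b::comm_semiring_1 \<Rightarrow> 'b" where
  "trace q z = z + z ^ q"

lemma trace_poly: "poly (trace q p) a = trace q (poly p a)"
  by (simp add: trace_def poly_power)

definition permutation_polynomial :: "'a::finite_field poly \<Rightarrow> bool" where
  "permutation_polynomial f \<longleftrightarrow> bij (poly f)"

(* Polynomials count only through the maps they induce, so g is determined as a map and need
   not be reduced modulo x ^ CARD('a) - x. *)
definition is_compositional_inverse :: "'a::finite_field poly \<Rightarrow> 'a poly \<Rightarrow> bool" where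
  "is_compositional_inverse f g \<longleftrightarrow>
     (\<forall>x. poly f (poly g x) = x \<and> poly g (poly f x) = x)"

abbreviation var :: "'a::comm_semiring_1 poly" where
  "var \<equiv> [:0, 1:]"

definition f2 :: "nat \<Rightarrow> 'a::finite_field \<Rightarrow> 'a poly" where
  "f2 q \<gamma> = var + smult \<gamma> (trace q (var + var ^ 2 + var ^ 3 + var ^ (q + 2)))"

definition f2_inverse :: "nat \<Rightarrow> 'a::finite_field \<Rightarrow> 'a poly" where
  "f2_inverse q \<gamma> = var + smult \<gamma> (trace q var) + smult \<gamma> ((trace q var) ^ 2)
     + smult \<gamma> ((trace q var) ^ 3)"

end

theory Submission
  imports Defs
begin

text \<open>
  Write \<open>T\<close> for the trace and let \<open>y = x ^ q\<close>, so that \<open>y ^ q = x\<close>. In characteristic 2 the trace of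
  \<open>x + x\<^sup>2 + x\<^sup>3 + x ^ (q + 2)\<close> is a polynomial in \<open>T x = x + y\<close> alone: the mixed terms
  \<open>x\<^sup>2 y + x y\<^sup>2\<close> coming from the exponent \<open>q + 2\<close> are exactly those that complete \<open>x\<^sup>3 + y\<^sup>3\<close> to
  \<open>(x + y)\<^sup>3\<close>. Hence the polynomial and its claimed inverse induce the same map
  \<open>x \<mapsto> x + \<gamma> (T x + (T x)\<^sup>2 + (T x)\<^sup>3)\<close>, and it remains to see that this map is an involution.

  The summand added to \<open>x\<close> lies in the subfield \<open>\<bbbF>\<^sub>q\<close>, whose elements are fixed by the \<open>q\<close>-power map and
  therefore have trace \<open>c + c = 0\<close>. So the map leaves \<open>T x\<close> unchanged, and applying it again adds
  the same summand a second time, which cancels the first one in characteristic 2.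
\<close>

text \<open>
  Multiplication by a nonzero \<open>a\<close> in the subfield permutes its nonzero elements, so comparing the
  products of all nonzero elements before and after gives \<open>a ^ (card K - 1) = 1\<close>.
\<close>
lemma subfield_power_card_eq_same:
  fixes K :: "'a::field set"
  assumes K: "subfield K (ring_of_type_algebra :: 'a ring)" and "finite K" and "a \<in> K"
  shows "a ^ card K = a"
proof (cases "a = 0")
  case True
  have "card K \<noteq> 0" using assms by auto
  with True show ?thesis by (simp add: power_0_left)
next
  case False
  have mult: "x * y \<in> K" if "x \<in> K" "y \<in> K" for x y
    using subringE(6)[OF subfieldE(1)[OF K] that] by (simp add: ring_of_type_algebra_def)
  have zero: "0 \<in> K"
    using subringE(2)[OF subfieldE(1)[OF K]] by (simp add: ring_of_type_algebra_def)
  have inj: "inj_on ((*) a) (K - {0})"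
    using False by (auto intro: inj_onI)
  have image: "(*) a ` (K - {0}) = K - {0}"
    using assms(2) inj mult[OF \<open>a \<in> K\<close>] False
    by (intro endo_inj_surj) auto
  have "(\<Prod>x\<in>K - {0}. x) = (\<Prod>x\<in>(*) a ` (K - {0}). x)"
    using image by simp
  also have "\<dots> = (\<Prod>x\<in>K - {0}. a * x)"
    using inj by (simp add: prod.reindex)
  also have "\<dots> = a ^ card (K - {0}) * (\<Prod>x\<in>K - {0}. x)"
    by (simp add: prod.distrib)
  finally have "a ^ card (K - {0}) = 1"
    using assms(2) by simp
  moreover have "card K = Suc (card (K - {0}))"
    using card.remove[OF assms(2) zero] .
  ultimately show ?thesis by simp
qed

text \<open>
  Every element is fixed by the power map with exponent \<open>CARD('a)\<close>; for the element \<open>-1\<close> and an even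
  exponent this reads \<open>1 = -1\<close>.
\<close>
lemma CHAR_eq_2_if_even_CARD:
  assumes "even CARD('a::finite_field)"
  shows "CHAR('a) = 2"
proof -
  have "(-1 :: 'a) ^ CARD('a) = -1"
    by (rule finite_field_power_card_eq_same)
  with assms have "(1 :: 'a) = -1" by simp
  hence "(of_nat 2 :: 'a) = 0"
    by (simp add: eq_neg_iff_add_eq_0)
  hence "CHAR('a) dvd 2"
    by (simp only: of_nat_eq_0_iff_char_dvd)
  moreover have "CHAR('a) \<noteq> 1" by simp
  ultimately show ?thesis
    by (metis prime_nat_iff two_is_prime_nat)
qed

lemma add_self_CHAR_2:
  assumes "CHAR('a::comm_ring_1) = 2"
  shows "x + x = (0 :: 'a)"
  using minus_CHAR_2[OF assms, of x x] by simp

text \<open>An element \<open>c\<close> fixed by the \<open>q\<close>-power map has trace \<open>c + c = 0\<close>.\<close>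
lemma trace_add_fixed:
  fixes x c :: "'a::comm_ring_1"
  assumes "CHAR('a) = 2" and "q = 2 ^ m" and "c ^ q = c"
  shows "trace q (x + c) = trace q x"
proof -
  have "(x + c) ^ q = x ^ q + c"
    using freshmans_dream'[of q m x c] assms by simp
  hence "trace q (x + c) = trace q x + (c + c)"
    by (simp add: trace_def algebra_simps)
  thus ?thesis
    by (simp add: add_self_CHAR_2[OF assms(1)])
qed

lemma trace_power_eq_same:
  fixes x :: "'a::comm_ring_1"
  assumes "CHAR('a) = 2" and "q = 2 ^ m" and "x ^ q\<^sup>2 = x"
  shows "trace q x ^ q = trace q x"
  using freshmans_dream'[of q m x "x ^ q"] assms
  by (simp add: trace_def add.commute flip: power_mult power2_eq_square)

text \<open>
  The term \<open>x ^ (q + 2) = y x\<^sup>2\<close> and its \<open>q\<close>-th power \<open>x y\<^sup>2\<close>, where \<open>y = x ^ q\<close>, supply modulo 2 the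
  mixed terms in the expansion of \<open>(x + y)\<^sup>3\<close>.
\<close>
lemma trace_cubic:
  fixes x :: "'a::comm_ring_1"
  assumes char: "CHAR('a) = 2" and q: "q = 2 ^ m" and x: "x ^ q\<^sup>2 = x"
  shows "trace q (x + x\<^sup>2 + x ^ 3 + x ^ (q + 2)) = trace q x + (trace q x)\<^sup>2 + trace q x ^ 3"
proof -
  define y where "y = x ^ q"
  have frob: "(u + v) ^ q = u ^ q + v ^ q" for u v :: 'a
    using freshmans_dream'[of q m u v] char q by simp
  have y_q: "y ^ q = x"
    using x by (simp add: y_def flip: power_mult power2_eq_square)
  have pow: "(x ^ n) ^ q = y ^ n" for n
    by (simp add: y_def mult.commute flip: power_mult)
  have mixed: "x ^ (q + 2) = y * x\<^sup>2"
    by (simp only: power_add y_def)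
  have "(y * x\<^sup>2) ^ q = x * y\<^sup>2"
    using y_q pow[of 2] by (simp add: power_mult_distrib)
  hence "trace q (x + x\<^sup>2 + x ^ 3 + x ^ (q + 2))
      = x + x\<^sup>2 + x ^ 3 + y * x\<^sup>2 + (y + y\<^sup>2 + y ^ 3 + x * y\<^sup>2)"
    by (simp only: mixed trace_def frob pow flip: y_def)
  moreover have "(x + y) + (x + y)\<^sup>2 + (x + y) ^ 3
      = x + x\<^sup>2 + x ^ 3 + y * x\<^sup>2 + (y + y\<^sup>2 + y ^ 3 + x * y\<^sup>2)
        + ((x * y + y * x\<^sup>2 + x * y\<^sup>2) + (x * y + y * x\<^sup>2 + x * y\<^sup>2))"
    by (simp add: power2_eq_square power3_eq_cube algebra_simps)
  ultimately show ?thesis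
    by (simp only: add_self_CHAR_2[OF char] add_0_right trace_def flip: y_def)
qed

theorem theorem3p2:
  fixes m q :: nat and \<gamma> :: "'a::finite_field" and K :: "'a set"
  assumes "m > 0" and "q = 2 ^ m"
    and "CARD('a) = q ^ 2"
    and "subfield K (ring_of_type_algebra :: 'a ring)" and "card K = q"
    and "\<gamma> \<in> K"
  shows "permutation_polynomial (f2 q \<gamma>) \<and>
         is_compositional_inverse (f2 q \<gamma>) (f2_inverse q \<gamma>)"
proof -
  define g where "g t = \<gamma> * (t + t\<^sup>2 + t ^ 3)" for t
  have char: "CHAR('a) = 2"
    using assms(1-3) by (intro CHAR_eq_2_if_even_CARD) simp
  have gamma: "\<gamma> ^ q = \<gamma>"
    using subfield_power_card_eq_same[OF assms(4) finite assms(6)] assms(5) by simp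
  have x_q2: "x ^ q\<^sup>2 = x" for x :: 'a
    using finite_field_power_card_eq_same[of x] assms(3) by simp
  have f2: "poly (f2 q \<gamma>) x = x + g (trace q x)" for x
    using trace_cubic[OF char assms(2) x_q2]
    by (simp add: f2_def g_def trace_poly poly_power del: power_Suc)
  have f2_inverse: "poly (f2_inverse q \<gamma>) x = x + g (trace q x)" for x
    by (simp add: f2_inverse_def g_def trace_poly poly_power algebra_simps)
  have g_fixed: "g t ^ q = g t" if "t ^ q = t" for t
  proof -
    have frob: "(u + v) ^ q = u ^ q + v ^ q" for u v :: 'a
      using freshmans_dream'[of q m u v] char assms(2) by simp
    have "(t ^ n) ^ q = t ^ n" for n
      using that by (metis mult.commute power_mult)
    with that gamma show ?thesis
      by (simp add: g_def power_mult_distrib frob)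
  qed
  have "trace q (x + g (trace q x)) = trace q x" for x
    using trace_add_fixed[OF char assms(2)] g_fixed
      trace_power_eq_same[OF char assms(2) x_q2] by blast
  hence invol: "x + g (trace q x) + g (trace q (x + g (trace q x))) = x" for x
    by (simp add: add.assoc add_self_CHAR_2[OF char])
  have "is_compositional_inverse (f2 q \<gamma>) (f2_inverse q \<gamma>)"
    by (simp add: is_compositional_inverse_def f2 f2_inverse invol)
  moreover have "permutation_polynomial (f2 q \<gamma>)"
    unfolding permutation_polynomial_def
    by (rule involuntory_imp_bij) (simp add: f2 invol)
  ultimately show ?thesis by blast
qed

end
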